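(* Let $L$ be a bounded chain, let $n\geqslant 1$, and let $f\colon L^{n}\rightarrow L$ be a function. The following conditions are equivalent: (i) $f$ is a polynomial function. (ii) $f$ is weakly $\overline{\mathcal{R}}_f$-min homogeneous and comonotonic maxitive. (iii) $f$ is comonotonic minitive and weakly $\overline{\mathcal{R}}_f$-max homogeneous. (iv) $f$ is $\overline{\mathcal{R}}_f$-idempotent, weakly horizontally $\overline{\mathcal{R}}_f$-minitive, and comonotonic maxitive. (v) $f$ is $\overline{\mathcal{R}}_f$-idempotent, comonotonic minitive, and weakly horizontally $\overline{\mathcal{R}}_f$-maxitive. (vi) $f$ is $\overline{\mathcal{R}}_f$-idempotent, comonotonic minitive, and comonotonic maxitive.
   Context: A bounded chain is a totally ordered set $L$ with least element $0$ and greatest element $1$, viewed as a lattice with $\wedge=\min$, $\vee=\max$. $L^n$ has the componentwise order and operations. A polynomial function $L^n\to L$ is any function obtained by finitely many applications of: (i) for each $i\in\{1,\ldots,n\}$ and $c\in L$, the projection $\mathbf{x}\mapsto x_i$ and the constant function $\mathbf{x}\mapsto c$ are polynomial functions; (ii) if $f,g$ are polynomial functions then so are $f\vee g$ and $f\wedge g$ (pointwise). $\mathcal{R}_f=\{f(\mathbf{x}):\mathbf{x}\in L^n\}$ is the range of $f$, and $\overline{\mathcal{R}}_f$ is its convex hull, i.e. the smallest convex subset of $L$ containing $\mathcal{R}_f$ ($S\subseteq L$ is convex if $a,b\in S$, $c\in L$, $a\leqslant c\leqslant b$ imply $c\in S$). For $c\in L$ and $\mathbf{x}\in L^n$: $\mathbf{x}\wedge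 c=(x_1\wedge c,\ldots,x_n\wedge c)$, $\mathbf{x}\vee c=(x_1\vee c,\ldots,x_n\vee c)$; $[\mathbf{x}]^c$ is the $n$-tuple whose $i$th component is $1$ if $x_i\geqslant c$ and $x_i$ otherwise; $[\mathbf{x}]_c$ is the $n$-tuple whose $i$th component is $0$ if $x_i\leqslant c$ and $x_i$ otherwise. Let $L_n^{(0,2)}=\{\mathbf{x}\in L^n: |\{x_1,\ldots,x_n\}|\leqslant 2\}$. For nonempty $S\subseteq L$, $f$ is: - $S$-idempotent if $f(c,\ldots,c)=c$ for all $c\in S$; - weakly $S$-min homogeneous if $f(\mathbf{x}\wedge c)=f(\mathbf{x})\wedge c$ for all $\mathbf{x}\in L_n^{(0,2)}$, $c\in S$; - weakly $S$-max homogeneous if $f(\mathbf{x}\vee c)=f(\mathbf{x})\vee c$ for all $\mathbf{x}\in L_n^{(0,2)}$, $c\in S$; - weakly horizontally $S$-minitive if $f(\mathbf{x})=f(\mathbf{x}\vee c)\wedge f([\mathbf{x}]^c)$ for all $\mathbf{x}\in L_n^{(0,2)}$, $c\in S$; - weakly horizontally $S$-maxitive if $f(\mathbf{x})=f(\mathbf{x}\wedge c)\vee f([\mathbf{x}]_c)$ for all $\mathbf{x}\in L_n^{(0,2)}$, $c\in S$. Vectors $\mathbf{x},\mathbf{x}'\in L^n$ are comonotonic if there is a permutation $\sigma$ of $\{1,\ldots,n\}$ with $x_{\sigma(1)}\leqslant\cdots\leqslant x_{\sigma(n)}$ and $x'_{\sigma(1)}\leqslant\cdots\leqslant x'_{\sigma(n)}$.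 $f$ is comonotonic minitive if $f(\mathbf{x}\wedge\mathbf{x}')=f(\mathbf{x})\wedge f(\mathbf{x}')$ for all comonotonic $\mathbf{x},\mathbf{x}'\in L^n$, and comonotonic maxitive if $f(\mathbf{x}\vee\mathbf{x}')=f(\mathbf{x})\vee f(\mathbf{x}')$ for all comonotonic $\mathbf{x},\mathbf{x}'\in L^n$. *)

theory Defs
  imports Complex_Main
begin

(* A bounded chain is a type of sort {linorder, bounded_lattice}, with 0 = bot and 1 = top; in this
   sort inf and sup coincide with min and max (inf_min, sup_max). A tuple in L^n is a function
   'n => 'a on a finite index type 'n (so n = CARD('n) >= 1), with the componentwise order and
   lattice operations of function types. Where the order of the indices {1..n} is used, 'n is
   moreover a linorder. *)

inductive lattice_polynomial ::
    "(('n::finite \<Rightarrow> 'a::{linorder, bounded_lattice}) \<Rightarrow> 'a) \<Rightarrow> bool" where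
  proj: "lattice_polynomial (\<lambda>x. x i)"
| const: "lattice_polynomial (\<lambda>x. c)"
| sup: "lattice_polynomial f \<Longrightarrow> lattice_polynomial g \<Longrightarrow> lattice_polynomial (\<lambda>x. sup (f x) (g x))"
| inf: "lattice_polynomial f \<Longrightarrow> lattice_polynomial g \<Longrightarrow> lattice_polynomial (\<lambda>x. inf (f x) (g x))"

definition order_convex :: "'a::order set \<Rightarrow> bool" where
  "order_convex S \<longleftrightarrow> (\<forall>a\<in>S. \<forall>b\<in>S. \<forall>c. a \<le> c \<and> c \<le> b \<longrightarrow> c \<in> S)"

definition range_hull :: "('b \<Rightarrow> 'a::order) \<Rightarrow> 'a set" where
  "range_hull f = order_convex hull (range f)"

definition inf_const :: "('n \<Rightarrow> 'a::semilattice_inf) \<Rightarrow> 'a \<Rightarrow> 'n \<Rightarrow> 'a" where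
  "inf_const x c = (\<lambda>i. inf (x i) c)"

definition sup_const :: "('n \<Rightarrow> 'a::semilattice_sup) \<Rightarrow> 'a \<Rightarrow> 'n \<Rightarrow> 'a" where
  "sup_const x c = (\<lambda>i. sup (x i) c)"

(* [x]^c *)
definition raise_above :: "('n \<Rightarrow> 'a::order_top) \<Rightarrow> 'a \<Rightarrow> 'n \<Rightarrow> 'a" where
  "raise_above x c = (\<lambda>i. if x i \<ge> c then top else x i)"

(* [x]_c *)
definition lower_below :: "('n \<Rightarrow> 'a::order_bot) \<Rightarrow> 'a \<Rightarrow> 'n \<Rightarrow> 'a" where
  "lower_below x c = (\<lambda>i. if x i \<le> c then bot else x i)"

(* L_n^(0,2) *)
definition two_valued :: "('n::finite \<Rightarrow> 'a) set" where
  "two_valued = {x. card (range x) \<le> 2}"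

definition idempotent_on :: "'a set \<Rightarrow> (('n \<Rightarrow> 'a) \<Rightarrow> 'a) \<Rightarrow> bool" where
  "idempotent_on S f \<longleftrightarrow> (\<forall>c\<in>S. f (\<lambda>_. c) = c)"

definition weakly_min_homogeneous ::
    "'a::{linorder, bounded_lattice} set \<Rightarrow> (('n::finite \<Rightarrow> 'a) \<Rightarrow> 'a) \<Rightarrow> bool" where
  "weakly_min_homogeneous S f \<longleftrightarrow>
     (\<forall>x\<in>two_valued. \<forall>c\<in>S. f (inf_const x c) = inf (f x) c)"

definition weakly_max_homogeneous ::
    "'a::{linorder, bounded_lattice} set \<Rightarrow> (('n::finite \<Rightarrow> 'a) \<Rightarrow> 'a) \<Rightarrow> bool" where
  "weakly_max_homogeneous S f \<longleftrightarrow>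
     (\<forall>x\<in>two_valued. \<forall>c\<in>S. f (sup_const x c) = sup (f x) c)"

definition weakly_horizontally_minitive ::
    "'a::{linorder, bounded_lattice} set \<Rightarrow> (('n::finite \<Rightarrow> 'a) \<Rightarrow> 'a) \<Rightarrow> bool" where
  "weakly_horizontally_minitive S f \<longleftrightarrow>
     (\<forall>x\<in>two_valued. \<forall>c\<in>S. f x = inf (f (sup_const x c)) (f (raise_above x c)))"

definition weakly_horizontally_maxitive ::
    "'a::{linorder, bounded_lattice} set \<Rightarrow> (('n::finite \<Rightarrow> 'a) \<Rightarrow> 'a) \<Rightarrow> bool" where
  "weakly_horizontally_maxitive S f \<longleftrightarrow>
     (\<forall>x\<in>two_valued. \<forall>c\<in>S. f x = sup (f (inf_const x c)) (f (lower_below x c)))"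

definition comonotonic :: "('n::{finite, linorder} \<Rightarrow> 'a::order) \<Rightarrow> ('n \<Rightarrow> 'a) \<Rightarrow> bool" where
  "comonotonic x x' \<longleftrightarrow> (\<exists>\<sigma>::'n \<Rightarrow> 'n. bij \<sigma> \<and> mono (x \<circ> \<sigma>) \<and> mono (x' \<circ> \<sigma>))"

definition comonotonic_minitive ::
    "(('n::{finite, linorder} \<Rightarrow> 'a::{linorder, bounded_lattice}) \<Rightarrow> 'a) \<Rightarrow> bool" where
  "comonotonic_minitive f \<longleftrightarrow> (\<forall>x x'. comonotonic x x' \<longrightarrow> f (inf x x') = inf (f x) (f x'))"

definition comonotonic_maxitive ::
    "(('n::{finite, linorder} \<Rightarrow> 'a::{linorder, bounded_lattice}) \<Rightarrow> 'a) \<Rightarrow> bool" where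
  "comonotonic_maxitive f \<longleftrightarrow> (\<forall>x x'. comonotonic x x' \<longrightarrow> f (sup x x') = sup (f x) (f x'))"

end

theory Submission
  imports Defs "HOL-Library.Product_Lexorder" "HOL-Library.Dual_Ordered_Lattice"
begin

text \<open>
  A tuple over a chain is determined by its upper cuts \<open>{i. m \<le> x i}\<close>, and lattice operations are
  computed level by level: whether \<open>m \<le> f x\<close> holds for a polynomial \<open>f\<close> depends only, and
  monotonically, on the cut of \<open>x\<close> at \<open>m\<close>. This property, \<open>cut_monotone\<close>, characterises the
  polynomial functions: by \<open>cut_monotone_disjunctive_form\<close> it makes \<open>f\<close> equal to the disjunctive
  normal form whose coefficients are the values of \<open>f\<close> at the tuples of \<open>bot\<close>s and \<open>top\<close>s.

  Cut monotonicity yields all the properties of the theorem: each of them is an identity which can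
  be checked one level \<open>m\<close> at a time, where it compares cuts. For comonotonic minitivity and
  maxitivity the point is that comonotonic tuples have nested cuts at each level. So the cut of
  \<open>sup x y\<close> is the larger and that of \<open>inf x y\<close> the smaller of the two cuts.

  Conversely, let \<open>f\<close> be idempotent and comonotonic maxitive, and write \<open>step_tuple A c\<close> for the
  tuple which is \<open>c\<close> on \<open>A\<close> and \<open>bot\<close> elsewhere. Levels \<open>m\<close> below all values of \<open>f\<close> are
  trivial. For the others, if \<open>m \<le> f x\<close> and \<open>A\<close> is the cut of \<open>x\<close> at \<open>m\<close>, then \<open>x\<close> lies below
  the join of \<open>step_tuple A top\<close> with a constant tuple of value less than \<open>m\<close>.
  Maxitivity splits the value at this join, and idempotence rules out the constant part, so
  \<open>m \<le> f (step_tuple A top)\<close> (\<open>le_value_of_cut_indicator\<close>). To return to a tuple \<open>y\<close> whose cut at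
  \<open>m\<close> contains \<open>A\<close>, the value at level \<open>top\<close> has to be carried down to level \<open>m\<close>, i.e.
  \<open>m \<le> f (step_tuple A m)\<close>. This is all that remains to be taken from min homogeneity, horizontal
  minitivity or comonotonic minitivity, and \<open>cut_monotoneI\<close> has it as a hypothesis. The two
  conditions which combine comonotonic minitivity with max homogeneity or horizontal maxitivity
  reduce to their mirror images by passing to the dual chain.
\<close>

section \<open>Comonotonic tuples\<close>

lemma exists_sorting_permutation:
  fixes key :: "'n::{finite, linorder} \<Rightarrow> 'k::linorder"
  shows "\<exists>\<sigma> :: 'n \<Rightarrow> 'n. bij \<sigma> \<and> mono (key \<circ> \<sigma>)"
proof -
  define xs where "xs = sort_key key (sorted_list_of_set (UNIV :: 'n set))"
  define rank where "rank i = card {..<i}" for i :: 'n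
  have len: "length xs = card (UNIV :: 'n set)"
    and dist: "distinct xs" and sorted: "sorted (map key xs)"
    by (simp_all add: xs_def)
  have rank_mono: "rank i \<le> rank j" if "i \<le> j" for i j
    unfolding rank_def using that by (intro card_mono) auto
  have rank_less: "rank i < length xs" for i
    unfolding rank_def len by (intro psubset_card_mono) auto
  have "rank i < rank j" if "i < j" for i j
    unfolding rank_def using that by (intro psubset_card_mono) auto
  then have "inj rank"
    by (metis injI less_irrefl neq_iff)
  then have "inj (\<lambda>i. xs ! rank i)"
    using dist rank_less by (auto simp: inj_def nth_eq_iff_index_eq)
  then have "bij (\<lambda>i. xs ! rank i)"
    by (simp add: bij_def finite_UNIV_inj_surj)
  moreover have "mono (key \<circ> (\<lambda>i. xs ! rank i))"
    using sorted_nth_mono[OF sorted] rank_mono rank_less by (intro monoI) simp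
  ultimately show ?thesis by blast
qed

text \<open>Sorting the indices lexicographically by the pairs \<open>(x i, y i)\<close> gives the common permutation.\<close>

lemma comonotonic_iff:
  fixes x y :: "'n::{finite, linorder} \<Rightarrow> 'a::linorder"
  shows "comonotonic x y \<longleftrightarrow> (\<forall>i j. x i < x j \<longrightarrow> y i \<le> y j)"
proof
  assume "comonotonic x y"
  then obtain \<sigma> :: "'n \<Rightarrow> 'n" where \<sigma>: "bij \<sigma>" "mono (x \<circ> \<sigma>)" "mono (y \<circ> \<sigma>)"
    unfolding comonotonic_def by blast
  show "\<forall>i j. x i < x j \<longrightarrow> y i \<le> y j"
  proof (intro allI impI)
    fix i j assume less: "x i < x j"
    obtain k l where kl: "i = \<sigma> k" "j = \<sigma> l"
      using \<sigma>(1) by (meson bij_pointE)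
    have "k \<le> l"
      using less monoD[OF \<sigma>(2), of l k] kl by fastforce
    then show "y i \<le> y j"
      using monoD[OF \<sigma>(3)] kl by fastforce
  qed
next
  assume pairwise: "\<forall>i j. x i < x j \<longrightarrow> y i \<le> y j"
  obtain \<sigma> :: "'n \<Rightarrow> 'n" where \<sigma>: "bij \<sigma>" "mono ((\<lambda>i. (x i, y i)) \<circ> \<sigma>)"
    using exists_sorting_permutation by blast
  have lex: "x (\<sigma> i) < x (\<sigma> j) \<or> x (\<sigma> i) \<le> x (\<sigma> j) \<and> y (\<sigma> i) \<le> y (\<sigma> j)" if "i \<le> j" for i j
    using monoD[OF \<sigma>(2) that] by simp
  have "mono (x \<circ> \<sigma>)" "mono (y \<circ> \<sigma>)"
    using lex pairwise by (fastforce intro!: monoI)+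
  with \<sigma>(1) show "comonotonic x y"
    unfolding comonotonic_def by blast
qed

text \<open>
  If neither inclusion held, an index in one difference and an index in the other would be ordered
  oppositely by \<open>x\<close> and \<open>y\<close>.
\<close>

lemma comonotonic_cuts_nested:
  fixes x y :: "'n::{finite, linorder} \<Rightarrow> 'a::linorder"
  assumes "comonotonic x y"
  shows "(\<forall>i. m \<le> x i \<longrightarrow> m \<le> y i) \<or> (\<forall>i. m \<le> y i \<longrightarrow> m \<le> x i)"
proof (rule ccontr)
  assume "\<not> ?thesis"
  then obtain i j where "m \<le> x i" "y i < m" "m \<le> y j" "x j < m"
    by (auto simp: not_le)
  then have "x j < x i" "y i < y j" by order+
  with assms show False
    by (auto simp: comonotonic_iff not_le[symmetric])
qed

text \<open>
  Without comonotonicity of the two tuples, \<open>x \<le> y\<close> does not make maxitivity applicable to them.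
\<close>

lemma comonotonic_maxitive_mono:
  assumes "comonotonic_maxitive f" "comonotonic x y" "x \<le> y"
  shows "f x \<le> f y"
proof -
  have "f y = sup (f x) (f y)"
    using assms unfolding comonotonic_maxitive_def by (metis sup_absorb2)
  then show ?thesis by (metis sup_ge1)
qed

section \<open>Range hulls and two-valued tuples\<close>

lemma range_hull_iff: "c \<in> range_hull f \<longleftrightarrow> (\<exists>x y. f x \<le> c \<and> c \<le> f y)"
proof
  have "order_convex {c. \<exists>x y. f x \<le> c \<and> c \<le> f y}"
    unfolding order_convex_def by (blast intro: order_trans)
  moreover have "range f \<subseteq> {c. \<exists>x y. f x \<le> c \<and> c \<le> f y}"
    by blast
  ultimately have "range_hull f \<subseteq> {c. \<exists>x y. f x \<le> c \<and> c \<le> f y}"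
    unfolding range_hull_def by (intro hull_minimal)
  then show "c \<in> range_hull f \<Longrightarrow> \<exists>x y. f x \<le> c \<and> c \<le> f y" by blast
next
  assume "\<exists>x y. f x \<le> c \<and> c \<le> f y"
  then show "c \<in> range_hull f"
    unfolding range_hull_def hull_def order_convex_def by blast
qed

definition step_tuple :: "'n set \<Rightarrow> 'a \<Rightarrow> 'n \<Rightarrow> 'a::order_bot" where
  "step_tuple A c = (\<lambda>i. if i \<in> A then c else bot)"

lemma two_valued_subset: "range x \<subseteq> {a, b} \<Longrightarrow> x \<in> two_valued"
  unfolding two_valued_def
  using card_mono[of "{a, b}" "range x"] card_insert_le_m1[of 2 "{b}" a] by simp

lemma two_valued_step_tuple: "step_tuple A c \<in> two_valued"
  by (rule two_valued_subset[of _ c bot]) (auto simp: step_tuple_def)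

lemma two_valued_constant: "(\<lambda>_. c) \<in> two_valued"
  by (rule two_valued_subset[of _ c c]) auto

section \<open>Cut monotonicity characterises polynomial functions\<close>

definition cut_monotone :: "(('n \<Rightarrow> 'a::order) \<Rightarrow> 'a) \<Rightarrow> bool" where
  "cut_monotone f \<longleftrightarrow> (\<forall>m x y. (\<forall>i. m \<le> x i \<longrightarrow> m \<le> y i) \<longrightarrow> m \<le> f x \<longrightarrow> m \<le> f y)"

lemma cut_monotoneD:
  "cut_monotone f \<Longrightarrow> m \<le> f x \<Longrightarrow> (\<And>i. m \<le> x i \<Longrightarrow> m \<le> y i) \<Longrightarrow> m \<le> f y"
  unfolding cut_monotone_def by blast

lemma cut_monotone_mono: "cut_monotone f \<Longrightarrow> x \<le> y \<Longrightarrow> f x \<le> f y"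
  by (rule cut_monotoneD[of f _ x]) (auto simp: le_fun_def intro: order_trans)

lemma polynomial_cut_monotone:
  assumes "lattice_polynomial f"
  shows "cut_monotone f"
  using assms by induction (auto simp: cut_monotone_def le_sup_iff sup_max le_max_iff_disj)

lemma lattice_polynomial_Max:
  assumes "finite K" "K \<noteq> {}" "\<And>k. k \<in> K \<Longrightarrow> lattice_polynomial (p k)"
  shows "lattice_polynomial (\<lambda>x. Max ((\<lambda>k. p k x) ` K))"
  using assms
proof (induction K rule: finite_ne_induct)
  case (insert k K)
  then show ?case
    using lattice_polynomial.sup[of "p k" "\<lambda>x. Max ((\<lambda>k. p k x) ` K)"]
    by (simp add: sup_max)
qed simp

lemma lattice_polynomial_Min_top:
  assumes "finite I"
  shows "lattice_polynomial (\<lambda>x. Min (insert top (x ` I)))"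
  using assms
proof (induction I)
  case (insert i I)
  have "Min (insert top (x ` insert i I)) = inf (x i) (Min (insert top (x ` I)))"
    for x :: "'a \<Rightarrow> 'b"
    using insert.hyps by (simp add: inf_min insert_commute[of top])
  then show ?case
    using lattice_polynomial.inf[OF lattice_polynomial.proj insert.IH, of i] by simp
qed (simp add: lattice_polynomial.const)

text \<open>
  The term for \<open>I\<close> never exceeds \<open>f x\<close>, since at the level of its value \<open>I\<close> is contained in the
  cut of \<open>x\<close>. The term for the cut of \<open>x\<close> at level \<open>f x\<close> attains \<open>f x\<close>.
\<close>

lemma cut_monotone_disjunctive_form:
  fixes f :: "('n::finite \<Rightarrow> 'a::{linorder, bounded_lattice}) \<Rightarrow> 'a"
  assumes "cut_monotone f"
  shows "f x = Max ((\<lambda>I. inf (f (step_tuple I top)) (Min (insert top (x ` I)))) ` UNIV)"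
proof (rule antisym)
  define I where "I = {i. f x \<le> x i}"
  have "f x \<le> f (step_tuple I top)"
    by (rule cut_monotoneD[OF assms order_refl]) (simp add: I_def step_tuple_def)
  moreover have "f x \<le> Min (insert top (x ` I))"
    by (auto simp: I_def)
  ultimately have "f x \<le> inf (f (step_tuple I top)) (Min (insert top (x ` I)))" by simp
  also have "\<dots> \<le> Max ((\<lambda>I. inf (f (step_tuple I top)) (Min (insert top (x ` I)))) ` UNIV)"
    by (intro Max_ge) auto
  finally show "f x \<le> \<dots>" .
next
  have "inf (f (step_tuple I top)) (Min (insert top (x ` I))) \<le> f x" for I
  proof (rule cut_monotoneD[OF assms inf_le1])
    fix i
    assume le: "inf (f (step_tuple I top)) (Min (insert top (x ` I))) \<le> step_tuple I top i"
    show "inf (f (step_tuple I top)) (Min (insert top (x ` I))) \<le> x i"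
    proof (cases "i \<in> I")
      case True
      then show ?thesis by (intro le_infI2 Min_le) auto
    next
      case False
      with le show ?thesis by (simp add: step_tuple_def bot_unique)
    qed
  qed
  then show "Max ((\<lambda>I. inf (f (step_tuple I top)) (Min (insert top (x ` I)))) ` UNIV) \<le> f x"
    by (intro Max.boundedI) auto
qed

lemma cut_monotone_polynomial:
  fixes f :: "('n::finite \<Rightarrow> 'a::{linorder, bounded_lattice}) \<Rightarrow> 'a"
  assumes "cut_monotone f"
  shows "lattice_polynomial f"
proof -
  have "lattice_polynomial
      (\<lambda>x. Max ((\<lambda>I. inf (f (step_tuple I top)) (Min (insert top (x ` I)))) ` UNIV))"
    by (intro lattice_polynomial_Max lattice_polynomial.inf lattice_polynomial.const
        lattice_polynomial_Min_top) auto
  then show ?thesis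
    by (simp flip: cut_monotone_disjunctive_form[OF assms])
qed

section \<open>Properties of cut-monotone functions\<close>

lemma cut_monotone_comonotonic_maxitive:
  fixes f :: "('n::{finite, linorder} \<Rightarrow> 'a::{linorder, bounded_lattice}) \<Rightarrow> 'a"
  assumes "cut_monotone f"
  shows "comonotonic_maxitive f"
  unfolding comonotonic_maxitive_def
proof (intro allI impI antisym)
  fix x y :: "'n \<Rightarrow> 'a"
  assume "comonotonic x y"
  let ?m = "f (sup x y)"
  have cut: "?m \<le> sup x y i \<longleftrightarrow> ?m \<le> x i \<or> ?m \<le> y i" for i
    by (simp add: sup_max le_max_iff_disj)
  from comonotonic_cuts_nested[OF \<open>comonotonic x y\<close>]
  show "?m \<le> sup (f x) (f y)"
  proof
    assume "\<forall>i. ?m \<le> x i \<longrightarrow> ?m \<le> y i"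
    with cut have "?m \<le> f y"
      by (intro cut_monotoneD[OF assms order_refl]) blast
    then show ?thesis by (rule le_supI2)
  next
    assume "\<forall>i. ?m \<le> y i \<longrightarrow> ?m \<le> x i"
    with cut have "?m \<le> f x"
      by (intro cut_monotoneD[OF assms order_refl]) blast
    then show ?thesis by (rule le_supI1)
  qed
  show "sup (f x) (f y) \<le> f (sup x y)"
    by (simp add: cut_monotone_mono[OF assms])
qed

lemma cut_monotone_comonotonic_minitive:
  fixes f :: "('n::{finite, linorder} \<Rightarrow> 'a::{linorder, bounded_lattice}) \<Rightarrow> 'a"
  assumes "cut_monotone f"
  shows "comonotonic_minitive f"
  unfolding comonotonic_minitive_def
proof (intro allI impI antisym)
  fix x y :: "'n \<Rightarrow> 'a"
  assume "comonotonic x y"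
  let ?m = "inf (f x) (f y)"
  from comonotonic_cuts_nested[OF \<open>comonotonic x y\<close>]
  show "?m \<le> f (inf x y)"
  proof
    assume "\<forall>i. ?m \<le> x i \<longrightarrow> ?m \<le> y i"
    then show ?thesis
      by (intro cut_monotoneD[OF assms inf_le1]) (simp add: inf_greatest)
  next
    assume "\<forall>i. ?m \<le> y i \<longrightarrow> ?m \<le> x i"
    then show ?thesis
      by (intro cut_monotoneD[OF assms inf_le2]) (simp add: inf_greatest)
  qed
  show "f (inf x y) \<le> ?m"
    by (simp add: cut_monotone_mono[OF assms])
qed

text \<open>
  Above level \<open>c\<close> the constant tuple \<open>c\<close> has an empty cut, at and below level \<open>c\<close> it has the full
  cut, so its value can neither exceed \<open>c\<close> nor stay below it as long as \<open>f\<close> has values on both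
  sides of \<open>c\<close>.
\<close>

lemma cut_monotone_idempotent:
  fixes f :: "('n \<Rightarrow> 'a::linorder) \<Rightarrow> 'a"
  assumes "cut_monotone f"
  shows "idempotent_on (range_hull f) f"
  unfolding idempotent_on_def
proof
  fix c assume "c \<in> range_hull f"
  then obtain x y where xy: "f x \<le> c" "c \<le> f y"
    unfolding range_hull_iff by blast
  have ge: "c \<le> f (\<lambda>_. c)"
    by (rule cut_monotoneD[OF assms, OF xy(2)]) simp
  have "\<not> c < f (\<lambda>_. c)"
  proof
    assume "c < f (\<lambda>_. c)"
    then have "f (\<lambda>_. c) \<le> f x"
      by (intro cut_monotoneD[OF assms order_refl]) (auto dest: leD)
    with xy(1) \<open>c < f (\<lambda>_. c)\<close> show False by order
  qed
  with ge show "f (\<lambda>_. c) = c" by order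
qed

lemma cut_monotone_min_homogeneous:
  fixes f :: "('n::finite \<Rightarrow> 'a::{linorder, bounded_lattice}) \<Rightarrow> 'a"
  assumes "cut_monotone f" "c \<in> range_hull f"
  shows "f (inf_const x c) = inf (f x) c"
proof (rule antisym)
  have "f (inf_const x c) \<le> f x" "f (inf_const x c) \<le> f (\<lambda>_. c)"
    by (rule cut_monotone_mono[OF assms(1)], simp add: le_fun_def inf_const_def)+
  moreover have "f (\<lambda>_. c) = c"
    using cut_monotone_idempotent[OF assms(1)] assms(2) by (simp add: idempotent_on_def)
  ultimately show "f (inf_const x c) \<le> inf (f x) c" by simp
next
  show "inf (f x) c \<le> f (inf_const x c)"
    by (rule cut_monotoneD[OF assms(1) inf_le1]) (simp add: inf_const_def)
qed

lemma cut_monotone_max_homogeneous: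
  fixes f :: "('n::finite \<Rightarrow> 'a::{linorder, bounded_lattice}) \<Rightarrow> 'a"
  assumes "cut_monotone f" "c \<in> range_hull f"
  shows "f (sup_const x c) = sup (f x) c"
proof (rule antisym)
  have "f x \<le> f (sup_const x c)" "f (\<lambda>_. c) \<le> f (sup_const x c)"
    by (rule cut_monotone_mono[OF assms(1)], simp add: le_fun_def sup_const_def)+
  moreover have "f (\<lambda>_. c) = c"
    using cut_monotone_idempotent[OF assms(1)] assms(2) by (simp add: idempotent_on_def)
  ultimately show "sup (f x) c \<le> f (sup_const x c)" by simp
next
  show "f (sup_const x c) \<le> sup (f x) c"
  proof (cases "f (sup_const x c) \<le> c")
    case False
    have "f (sup_const x c) \<le> f x"
      by (rule cut_monotoneD[OF assms(1) order_refl])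
        (use False in \<open>simp add: sup_const_def sup_max le_max_iff_disj\<close>)
    then show ?thesis by (rule le_supI1)
  qed (rule le_supI2)
qed

text \<open>
  At levels up to \<open>c\<close> the tuples \<open>x\<close> and \<open>raise_above x c\<close> have the same cuts, at levels beyond \<open>c\<close>
  the tuples \<open>x\<close> and \<open>sup_const x c\<close> do.
\<close>

lemma cut_monotone_horizontally_minitive:
  fixes f :: "('n::finite \<Rightarrow> 'a::{linorder, bounded_lattice}) \<Rightarrow> 'a"
  assumes "cut_monotone f"
  shows "f x = inf (f (sup_const x c)) (f (raise_above x c))"
proof (rule antisym)
  show "f x \<le> inf (f (sup_const x c)) (f (raise_above x c))"
    by (simp add: cut_monotone_mono[OF assms] le_fun_def sup_const_def raise_above_def)
next
  let ?m = "inf (f (sup_const x c)) (f (raise_above x c))"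
  show "?m \<le> f x"
  proof (cases "?m \<le> c")
    case True
    show ?thesis
    proof (rule cut_monotoneD[OF assms inf_le2])
      fix i assume "?m \<le> raise_above x c i"
      with True show "?m \<le> x i"
        by (cases "c \<le> x i") (auto simp: raise_above_def intro: order_trans)
    qed
  next
    case False
    show ?thesis
    proof (rule cut_monotoneD[OF assms inf_le1])
      fix i assume "?m \<le> sup_const x c i"
      with False show "?m \<le> x i"
        unfolding sup_const_def sup_max le_max_iff_disj by blast
    qed
  qed
qed

text \<open>
  At levels up to \<open>c\<close> the tuples \<open>x\<close> and \<open>inf_const x c\<close> have the same cuts, at levels beyond \<open>c\<close>
  the tuples \<open>x\<close> and \<open>lower_below x c\<close> do.
\<close>

lemma cut_monotone_horizontally_maxitive:
  fixes f :: "('n::finite \<Rightarrow> 'a::{linorder, bounded_lattice}) \<Rightarrow> 'a"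
  assumes "cut_monotone f"
  shows "f x = sup (f (inf_const x c)) (f (lower_below x c))"
proof (rule antisym)
  show "sup (f (inf_const x c)) (f (lower_below x c)) \<le> f x"
    by (simp add: cut_monotone_mono[OF assms] le_fun_def inf_const_def lower_below_def)
next
  show "f x \<le> sup (f (inf_const x c)) (f (lower_below x c))"
  proof (cases "f x \<le> c")
    case True
    then have "f x \<le> f (inf_const x c)"
      by (intro cut_monotoneD[OF assms order_refl]) (simp add: inf_const_def)
    then show ?thesis by (rule le_supI1)
  next
    case False
    have "f x \<le> f (lower_below x c)"
    proof (rule cut_monotoneD[OF assms order_refl])
      fix i assume "f x \<le> x i"
      with False have "\<not> x i \<le> c" by order
      with \<open>f x \<le> x i\<close> show "f x \<le> lower_below x c i"
        by (simp add: lower_below_def)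
    qed
    then show ?thesis by (rule le_supI2)
  qed
qed

section \<open>Cut monotonicity from maxitivity\<close>

text \<open>
  The value of \<open>x\<close> splits into a part coming from the entries below \<open>m\<close>, which a constant tuple
  dominates, and a part coming from the cut, which \<open>step_tuple\<close> dominates.
\<close>

lemma le_value_of_cut_indicator:
  fixes f :: "('n::{finite, linorder} \<Rightarrow> 'a::{linorder, bounded_lattice}) \<Rightarrow> 'a"
  assumes idem: "idempotent_on (range_hull f) f" and max: "comonotonic_maxitive f"
    and le: "m \<le> f x"
  shows "m \<le> f (step_tuple {i. m \<le> x i} top)"
proof (cases "m \<le> f (\<lambda>_. bot)")
  case True
  also have "f (\<lambda>_. bot) \<le> f (step_tuple {i. m \<le> x i} top)"
    by (rule comonotonic_maxitive_mono[OF max]) (auto simp: comonotonic_iff le_fun_def)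
  finally show ?thesis .
next
  case False
  \<comment> \<open>Inserting \<open>f (\<lambda>_. bot)\<close> keeps \<open>q\<close> in the hull of the range.\<close>
  define q where "q = Max (insert (f (\<lambda>_. bot)) {x i | i. x i < m})"
  have fin: "finite (insert (f (\<lambda>_. bot)) {x i | i. x i < m})"
    by simp
  have "q < m"
    unfolding q_def using False by (subst Max_less_iff[OF fin]) auto
  have q_ge: "f (\<lambda>_. bot) \<le> q" "\<And>i. x i < m \<Longrightarrow> x i \<le> q"
    unfolding q_def by (auto intro!: Max_ge[OF fin])
  have "q \<in> range_hull f"
    unfolding range_hull_iff using q_ge(1) \<open>q < m\<close> le by (meson less_imp_le order_trans)
  then have idem_q: "f (\<lambda>_. q) = q"
    using idem by (simp add: idempotent_on_def)
  let ?s = "step_tuple {i. m \<le> x i} top"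
  let ?w = "sup (\<lambda>_. q) ?s"
  have "x \<le> ?w"
    using q_ge(2) by (auto simp: le_fun_def step_tuple_def not_le)
  moreover have "comonotonic x ?w"
    unfolding comonotonic_iff
    by (auto simp: step_tuple_def)
  ultimately have "m \<le> f ?w"
    using le comonotonic_maxitive_mono[OF max] by (meson order_trans)
  moreover have "comonotonic (\<lambda>_. q) ?s"
    by (simp add: comonotonic_iff)
  then have "f ?w = sup q (f ?s)"
    using max idem_q by (simp add: comonotonic_maxitive_def)
  ultimately show ?thesis
    using \<open>q < m\<close> by (simp add: sup_max le_max_iff_disj not_le[symmetric])
qed

text \<open>
  The value passes from \<open>x\<close> to \<open>y\<close> through three step tuples: with value \<open>top\<close> on the cut of \<open>x\<close>,
  with value \<open>m\<close> on the cut of \<open>x\<close>, and with value \<open>m\<close> on the cut of \<open>y\<close>. The hypothesis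
  \<open>descend\<close> is the only step that maxitivity and idempotence do not provide.
\<close>

lemma cut_monotoneI:
  fixes f :: "('n::{finite, linorder} \<Rightarrow> 'a::{linorder, bounded_lattice}) \<Rightarrow> 'a"
  assumes idem: "idempotent_on (range_hull f) f" and max: "comonotonic_maxitive f"
    and descend: "\<And>m A. m \<in> range_hull f \<Longrightarrow> m \<le> f (step_tuple A top) \<Longrightarrow> m \<le> f (step_tuple A m)"
  shows "cut_monotone f"
  unfolding cut_monotone_def
proof (intro allI impI)
  fix m x y
  assume cuts: "\<forall>i. m \<le> x i \<longrightarrow> m \<le> y i" and le: "m \<le> f x"
  let ?A = "{i. m \<le> x i}" and ?B = "{i. m \<le> y i}"
  show "m \<le> f y"
  proof (cases "m \<le> f (\<lambda>_. bot)")
    case True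
    also have "f (\<lambda>_. bot) \<le> f y"
      by (rule comonotonic_maxitive_mono[OF max]) (auto simp: comonotonic_iff le_fun_def)
    finally show ?thesis .
  next
    case False
    then have "m \<in> range_hull f"
      unfolding range_hull_iff using le by (meson linear)
    then have "m \<le> f (step_tuple ?A m)"
      using le_value_of_cut_indicator[OF idem max le] by (rule descend)
    \<comment> \<open>The tuple \<open>step_tuple ?A m\<close> need not be comonotonic with \<open>y\<close>, so the comparison
      goes through the cut of \<open>y\<close>.\<close>
    also have "\<dots> \<le> f (step_tuple ?B m)"
      using cuts by (intro comonotonic_maxitive_mono[OF max])
        (auto simp: comonotonic_iff le_fun_def step_tuple_def)
    also have "\<dots> \<le> f y"
      by (rule comonotonic_maxitive_mono[OF max])
        (auto simp: comonotonic_iff le_fun_def step_tuple_def bot_unique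
          split: if_splits intro: order_trans[OF less_imp_le[OF not_le_imp_less]])
    finally show ?thesis .
  qed
qed

lemma min_homogeneous_maxitive_cut_monotone:
  fixes f :: "('n::{finite, linorder} \<Rightarrow> 'a::{linorder, bounded_lattice}) \<Rightarrow> 'a"
  assumes hom: "weakly_min_homogeneous (range_hull f) f" and max: "comonotonic_maxitive f"
  shows "cut_monotone f"
proof (rule cut_monotoneI[OF _ max])
  show "idempotent_on (range_hull f) f"
    unfolding idempotent_on_def
  proof
    fix c assume c: "c \<in> range_hull f"
    then obtain x where "c \<le> f x"
      unfolding range_hull_iff by blast
    also have "\<dots> \<le> f (\<lambda>_. top)"
      by (rule comonotonic_maxitive_mono[OF max]) (auto simp: comonotonic_iff le_fun_def)
    finally have "c \<le> f (\<lambda>_. top)" .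
    moreover have "f (inf_const (\<lambda>_. top) c) = inf (f (\<lambda>_. top)) c"
      using hom c two_valued_constant[of top] unfolding weakly_min_homogeneous_def by blast
    ultimately show "f (\<lambda>_. c) = c"
      by (simp add: inf_const_def inf_absorb2)
  qed
next
  fix m A
  assume m: "m \<in> range_hull f" and le: "m \<le> f (step_tuple A top)"
  have "step_tuple A m = inf_const (step_tuple A top) m"
    by (auto simp: step_tuple_def inf_const_def)
  then have "f (step_tuple A m) = inf (f (step_tuple A top)) m"
    using hom m two_valued_step_tuple unfolding weakly_min_homogeneous_def by metis
  with le show "m \<le> f (step_tuple A m)" by simp
qed

lemma horizontally_minitive_maxitive_cut_monotone:
  fixes f :: "('n::{finite, linorder} \<Rightarrow> 'a::{linorder, bounded_lattice}) \<Rightarrow> 'a"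
  assumes idem: "idempotent_on (range_hull f) f"
    and hmin: "weakly_horizontally_minitive (range_hull f) f"
    and max: "comonotonic_maxitive f"
  shows "cut_monotone f"
proof (rule cut_monotoneI[OF idem max])
  fix m A
  assume m: "m \<in> range_hull f" and le: "m \<le> f (step_tuple A top)"
  show "m \<le> f (step_tuple A m)"
  proof (cases "m = bot")
    \<comment> \<open>At \<open>bot\<close>, \<open>raise_above\<close> would raise the entries outside \<open>A\<close> as well.\<close>
    case False
    then have "raise_above (step_tuple A m) m = step_tuple A top"
      and "sup_const (step_tuple A m) m = (\<lambda>_. m)"
      by (auto simp: step_tuple_def sup_const_def raise_above_def bot_unique)
    then have "f (step_tuple A m) = inf (f (\<lambda>_. m)) (f (step_tuple A top))"
      using hmin m two_valued_step_tuple unfolding weakly_horizontally_minitive_def by metis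
    with le idem m show ?thesis
      by (simp add: idempotent_on_def)
  qed simp
qed

lemma minitive_maxitive_cut_monotone:
  fixes f :: "('n::{finite, linorder} \<Rightarrow> 'a::{linorder, bounded_lattice}) \<Rightarrow> 'a"
  assumes idem: "idempotent_on (range_hull f) f"
    and min: "comonotonic_minitive f" and max: "comonotonic_maxitive f"
  shows "cut_monotone f"
proof (rule cut_monotoneI[OF idem max])
  fix m A
  assume m: "m \<in> range_hull f" and le: "m \<le> f (step_tuple A top)"
  have "step_tuple A m = inf (\<lambda>_. m) (step_tuple A top)"
    by (auto simp: step_tuple_def)
  moreover have "comonotonic (\<lambda>_. m) (step_tuple A top)"
    by (simp add: comonotonic_iff)
  ultimately have "f (step_tuple A m) = inf (f (\<lambda>_. m)) (f (step_tuple A top))"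
    using min unfolding comonotonic_minitive_def by metis
  with le idem m show "m \<le> f (step_tuple A m)"
    by (simp add: idempotent_on_def)
qed

section \<open>Passing to the dual chain\<close>

instance dual :: (linorder) linorder
  by standard (auto simp: dual_less_eq_iff)

definition dual_function :: "(('n \<Rightarrow> 'a) \<Rightarrow> 'a) \<Rightarrow> ('n \<Rightarrow> 'a dual) \<Rightarrow> 'a dual" where
  "dual_function f = (\<lambda>x. dual (f (\<lambda>i. undual (x i))))"

lemma polynomial_of_dual:
  assumes "lattice_polynomial g"
  shows "lattice_polynomial (\<lambda>x. undual (g (\<lambda>i. dual (x i))))"
  using assms by induction (simp_all add: lattice_polynomial.intros)

lemma cut_monotone_dual_imp_polynomial:
  fixes f :: "('n::finite \<Rightarrow> 'a::{linorder, bounded_lattice}) \<Rightarrow> 'a"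
  assumes "cut_monotone (dual_function f)"
  shows "lattice_polynomial f"
  using polynomial_of_dual[OF cut_monotone_polynomial[OF assms]]
  by (simp add: dual_function_def)

lemma range_hull_dual_function:
  fixes f :: "('n \<Rightarrow> 'a::order) \<Rightarrow> 'a"
  shows "c \<in> range_hull (dual_function f) \<longleftrightarrow> undual c \<in> range_hull f"
proof -
  have tuples: "(\<exists>x :: 'n \<Rightarrow> 'a dual. P (\<lambda>i. undual (x i))) \<longleftrightarrow> (\<exists>x. P x)" for P
  proof
    assume "\<exists>x. P x"
    then obtain x where "P x" ..
    then show "\<exists>x :: 'n \<Rightarrow> 'a dual. P (\<lambda>i. undual (x i))"
      by (intro exI[of _ "\<lambda>i. dual (x i)"]) simp
  qed blast
  have "c \<in> range_hull (dual_function f) \<longleftrightarrow>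
      (\<exists>x. undual c \<le> f (\<lambda>i. undual (x i))) \<and> (\<exists>y. f (\<lambda>i. undual (y i)) \<le> undual c)"
    by (auto simp: range_hull_iff dual_function_def dual_less_eq_iff)
  also have "\<dots> \<longleftrightarrow> undual c \<in> range_hull f"
    unfolding range_hull_iff tuples[of "\<lambda>x. undual c \<le> f x"] tuples[of "\<lambda>x. f x \<le> undual c"]
    by blast
  finally show ?thesis .
qed

lemma two_valued_undual: "x \<in> two_valued \<Longrightarrow> (\<lambda>i. undual (x i)) \<in> two_valued"
  unfolding two_valued_def
  using card_image_le[of "range x" undual] by (simp add: image_image)

lemma idempotent_on_dual:
  "idempotent_on (range_hull f) f \<Longrightarrow> idempotent_on (range_hull (dual_function f)) (dual_function f)"
  unfolding idempotent_on_def Ball_def range_hull_dual_function by (simp add: dual_function_def)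

lemma comonotonic_maxitive_dual:
  fixes f :: "('n::{finite, linorder} \<Rightarrow> 'a::{linorder, bounded_lattice}) \<Rightarrow> 'a"
  assumes "comonotonic_minitive f"
  shows "comonotonic_maxitive (dual_function f)"
  unfolding comonotonic_maxitive_def
proof (intro allI impI)
  fix x y :: "'n \<Rightarrow> 'a dual"
  assume "comonotonic x y"
  then have "comonotonic (\<lambda>i. undual (x i)) (\<lambda>i. undual (y i))"
    by (auto simp: comonotonic_iff dual_less_eq_iff dual_less_iff)
  with assms have "f (inf (\<lambda>i. undual (x i)) (\<lambda>i. undual (y i))) =
      inf (f (\<lambda>i. undual (x i))) (f (\<lambda>i. undual (y i)))"
    by (simp add: comonotonic_minitive_def)
  then show "dual_function f (sup x y) = sup (dual_function f x) (dual_function f y)"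
    by (simp add: dual_function_def inf_fun_def)
qed

lemma weakly_min_homogeneous_dual:
  fixes f :: "('n::finite \<Rightarrow> 'a::{linorder, bounded_lattice}) \<Rightarrow> 'a"
  assumes "weakly_max_homogeneous (range_hull f) f"
  shows "weakly_min_homogeneous (range_hull (dual_function f)) (dual_function f)"
  unfolding weakly_min_homogeneous_def
proof (intro ballI)
  fix x :: "'n \<Rightarrow> 'a dual" and c
  assume "x \<in> two_valued" "c \<in> range_hull (dual_function f)"
  then have "f (sup_const (\<lambda>i. undual (x i)) (undual c)) = sup (f (\<lambda>i. undual (x i))) (undual c)"
    using assms two_valued_undual
    unfolding weakly_max_homogeneous_def range_hull_dual_function by blast
  then show "dual_function f (inf_const x c) = inf (dual_function f x) c"
    by (simp add: dual_function_def inf_const_def sup_const_def)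
qed

lemma weakly_horizontally_minitive_dual:
  fixes f :: "('n::finite \<Rightarrow> 'a::{linorder, bounded_lattice}) \<Rightarrow> 'a"
  assumes "weakly_horizontally_maxitive (range_hull f) f"
  shows "weakly_horizontally_minitive (range_hull (dual_function f)) (dual_function f)"
  unfolding weakly_horizontally_minitive_def
proof (intro ballI)
  fix x :: "'n \<Rightarrow> 'a dual" and c
  assume "x \<in> two_valued" "c \<in> range_hull (dual_function f)"
  then have "f (\<lambda>i. undual (x i)) =
      sup (f (inf_const (\<lambda>i. undual (x i)) (undual c))) (f (lower_below (\<lambda>i. undual (x i)) (undual c)))"
    using assms two_valued_undual
    unfolding weakly_horizontally_maxitive_def range_hull_dual_function by blast
  moreover have "lower_below (\<lambda>i. undual (x i)) (undual c) = (\<lambda>i. undual (raise_above x c i))"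
    and "inf_const (\<lambda>i. undual (x i)) (undual c) = (\<lambda>i. undual (sup_const x c i))"
    by (auto simp: lower_below_def raise_above_def inf_const_def sup_const_def dual_less_eq_iff)
  ultimately show "dual_function f x =
      inf (dual_function f (sup_const x c)) (dual_function f (raise_above x c))"
    by (simp add: dual_function_def)
qed

section \<open>The equivalences\<close>

theorem theorem23:
  fixes f :: "('n::{finite, linorder} \<Rightarrow> 'a::{linorder, bounded_lattice}) \<Rightarrow> 'a"
  shows "(lattice_polynomial f \<longleftrightarrow>
            weakly_min_homogeneous (range_hull f) f \<and> comonotonic_maxitive f)
       \<and> (lattice_polynomial f \<longleftrightarrow>
            comonotonic_minitive f \<and> weakly_max_homogeneous (range_hull f) f)
       \<and> (lattice_polynomial f \<longleftrightarrow>
            idempotent_on (range_hull f) f \<and> weakly_horizontally_minitive (range_hull f) f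
            \<and> comonotonic_maxitive f)
       \<and> (lattice_polynomial f \<longleftrightarrow>
            idempotent_on (range_hull f) f \<and> comonotonic_minitive f
            \<and> weakly_horizontally_maxitive (range_hull f) f)
       \<and> (lattice_polynomial f \<longleftrightarrow>
            idempotent_on (range_hull f) f \<and> comonotonic_minitive f \<and> comonotonic_maxitive f)"
proof (intro conjI iffI)
  assume "lattice_polynomial f"
  then have cut: "cut_monotone f" by (rule polynomial_cut_monotone)
  show "comonotonic_maxitive f"
    using cut by (rule cut_monotone_comonotonic_maxitive)
  then show "comonotonic_maxitive f" "comonotonic_maxitive f" by simp_all
  show "comonotonic_minitive f"
    using cut by (rule cut_monotone_comonotonic_minitive)
  then show "comonotonic_minitive f" "comonotonic_minitive f" by simp_all
  show "idempotent_on (range_hull f) f"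
    using cut by (rule cut_monotone_idempotent)
  then show "idempotent_on (range_hull f) f" "idempotent_on (range_hull f) f" by simp_all
  show "weakly_min_homogeneous (range_hull f) f"
    by (simp add: weakly_min_homogeneous_def cut_monotone_min_homogeneous[OF cut])
  show "weakly_max_homogeneous (range_hull f) f"
    by (simp add: weakly_max_homogeneous_def cut_monotone_max_homogeneous[OF cut])
  show "weakly_horizontally_minitive (range_hull f) f"
    by (simp add: weakly_horizontally_minitive_def flip: cut_monotone_horizontally_minitive[OF cut])
  show "weakly_horizontally_maxitive (range_hull f) f"
    by (simp add: weakly_horizontally_maxitive_def flip: cut_monotone_horizontally_maxitive[OF cut])
next
  assume "weakly_min_homogeneous (range_hull f) f \<and> comonotonic_maxitive f"
  then show "lattice_polynomial f"
    by (intro cut_monotone_polynomial min_homogeneous_maxitive_cut_monotone) auto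
next
  assume "comonotonic_minitive f \<and> weakly_max_homogeneous (range_hull f) f"
  then show "lattice_polynomial f"
    by (intro cut_monotone_dual_imp_polynomial min_homogeneous_maxitive_cut_monotone
        weakly_min_homogeneous_dual comonotonic_maxitive_dual) auto
next
  assume "idempotent_on (range_hull f) f \<and> weakly_horizontally_minitive (range_hull f) f
    \<and> comonotonic_maxitive f"
  then show "lattice_polynomial f"
    by (intro cut_monotone_polynomial horizontally_minitive_maxitive_cut_monotone) auto
next
  assume "idempotent_on (range_hull f) f \<and> comonotonic_minitive f
    \<and> weakly_horizontally_maxitive (range_hull f) f"
  then show "lattice_polynomial f"
    by (intro cut_monotone_dual_imp_polynomial horizontally_minitive_maxitive_cut_monotone
        idempotent_on_dual weakly_horizontally_minitive_dual comonotonic_maxitive_dual) auto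
next
  assume "idempotent_on (range_hull f) f \<and> comonotonic_minitive f \<and> comonotonic_maxitive f"
  then show "lattice_polynomial f"
    by (intro cut_monotone_polynomial minitive_maxitive_cut_monotone) auto
qed

end
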